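(* (1) For every $H\in\mathcal{H}$, $K_{1,3}\le H$. (2) If $H\in\mathcal{H}$ and $H\le K_{1,3}$, then $H=K_{1,3}$ or $H=K^+_{1,3}$. In particular, $\{K_{1,3},K^+_{1,3}\}$ is the minimum element of the partially ordered set $(\mathcal{H}/\!\equiv,\le)$.
   Context: All graphs are finite and simple, considered up to isomorphism (so "$H=K_{1,3}$" means $H$ is isomorphic to $K_{1,3}$). An edge-colored graph is a pair $(G,c)$ with $c\colon E(G)\to\mathbb{N}$ an arbitrary map (not necessarily proper); it is colored in $t$ or more colors if $|c(E(G))|\ge t$. A subgraph (not necessarily induced) is rainbow if its edges receive pairwise distinct colors. $(G,c)$ is rainbow $H$-free if $G$ contains no rainbow subgraph isomorphic to $H$. For graphs $H_1,H_2$, write $H_1\le H_2$ if there is a positive integer $t$ such that every rainbow $H_1$-free edge-colored complete graph colored in $t$ or more colors is rainbow $H_2$-free. $\mathcal{H}$ denotes the set of connected finite simple graphs other than the paths $P_1,P_2,P_3,P_4$ ($P_k$ is the path on $k$ vertices). On $\mathcal{H}$, $H_1\equiv H_2$ means $H_1\le H_2$ and $H_2\le H_1$; for equivalence classes $\mathcal{A},\mathcal{B}$, $\mathcal{A}\le\mathcal{B}$ means $H_1\le H_2$ for some $H_1\in\mathcal{A}$, $H_2\in\mathcal{B}$; this is a partial order on $\mathcal{H}/\!\equiv$. $K_{1,k}$ is the star with $k$ leaves, and $K^+_{1,k}$ is obtained from $K_{1,k}$ by subdividing one edge with one new vertex. *)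

theory Defs
  imports Main
begin

record 'v ugraph =
  verts :: "'v set"
  edges :: "'v set set"

definition simple_graph :: "'v ugraph \<Rightarrow> bool" where
  "simple_graph G \<longleftrightarrow> finite (verts G) \<and> (\<forall>e\<in>edges G. e \<subseteq> verts G \<and> card e = 2)"

definition isomorphic :: "'v ugraph \<Rightarrow> 'w ugraph \<Rightarrow> bool" where
  "isomorphic G H \<longleftrightarrow> (\<exists>f. bij_betw f (verts G) (verts H) \<and> edges H = (\<lambda>e. f ` e) ` edges G)"

definition subgraph :: "'v ugraph \<Rightarrow> 'v ugraph \<Rightarrow> bool" where
  "subgraph S G \<longleftrightarrow> simple_graph S \<and> verts S \<subseteq> verts G \<and> edges S \<subseteq> edges G"

text \<open>The graph without vertices does not count as connected.\<close>
definition connected_graph :: "'v ugraph \<Rightarrow> bool" where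
  "connected_graph G \<longleftrightarrow> simple_graph G \<and> verts G \<noteq> {} \<and>
     (\<forall>u\<in>verts G. \<forall>v\<in>verts G. (u, v) \<in> {(x, y). {x, y} \<in> edges G}\<^sup>*)"

definition complete_graph :: "'v ugraph \<Rightarrow> bool" where
  "complete_graph G \<longleftrightarrow> simple_graph G \<and>
     (\<forall>u\<in>verts G. \<forall>v\<in>verts G. u \<noteq> v \<longrightarrow> {u, v} \<in> edges G)"

definition path_graph :: "nat \<Rightarrow> nat ugraph" where
  "path_graph k = \<lparr>verts = {0..<k}, edges = {{i, Suc i} | i. Suc i < k}\<rparr>"

definition star_graph :: "nat \<Rightarrow> nat ugraph" where
  "star_graph k = \<lparr>verts = {0..k}, edges = {{0, i} | i. i \<in> {1..k}}\<rparr>"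

definition subdivide :: "'v ugraph \<Rightarrow> 'v set \<Rightarrow> 'v \<Rightarrow> 'v ugraph" where
  "subdivide G e w =
     \<lparr>verts = insert w (verts G), edges = (edges G - {e}) \<union> {{x, w} | x. x \<in> e}\<rparr>"

definition star_plus_graph :: "nat \<Rightarrow> nat ugraph" where
  "star_plus_graph k = subdivide (star_graph k) {0, 1} (Suc k)"

text \<open>A coloring is a total function on vertex sets, but only its values on edges are ever used.\<close>

definition rainbow :: "('v set \<Rightarrow> nat) \<Rightarrow> 'v ugraph \<Rightarrow> bool" where
  "rainbow c S \<longleftrightarrow> inj_on c (edges S)"

definition rainbow_free :: "'w ugraph \<Rightarrow> 'v ugraph \<Rightarrow> ('v set \<Rightarrow> nat) \<Rightarrow> bool" where
  "rainbow_free H G c \<longleftrightarrow> \<not> (\<exists>S. subgraph S G \<and> isomorphic S H \<and> rainbow c S)"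

text \<open>
  Every finite graph has an isomorphic copy with vertices in \<^typ>\<open>nat\<close>, so from here on
  all graphs, hosts included, are taken on \<^typ>\<open>nat\<close>.
\<close>

definition rainbow_le :: "nat ugraph \<Rightarrow> nat ugraph \<Rightarrow> bool" where
  "rainbow_le H1 H2 \<longleftrightarrow>
     (\<exists>t>0. \<forall>(G :: nat ugraph) c. complete_graph G \<longrightarrow> card (c ` edges G) \<ge> t \<longrightarrow>
        rainbow_free H1 G c \<longrightarrow> rainbow_free H2 G c)"

definition conn_graphs :: "nat ugraph set" where
  "conn_graphs = {H. connected_graph H \<and> (\<forall>k\<in>{1,2,3,4}. \<not> isomorphic H (path_graph k))}"

definition rainbow_equiv :: "(nat ugraph \<times> nat ugraph) set" where
  "rainbow_equiv = {(H1, H2). H1 \<in> conn_graphs \<and> H2 \<in> conn_graphs \<and>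
     rainbow_le H1 H2 \<and> rainbow_le H2 H1}"

definition class_le :: "nat ugraph set \<Rightarrow> nat ugraph set \<Rightarrow> bool" where
  "class_le A B \<longleftrightarrow> (\<exists>H1\<in>A. \<exists>H2\<in>B. rainbow_le H1 H2)"

lemma rainbow_le_refl: "rainbow_le H H"
  unfolding rainbow_le_def by blast

lemma rainbow_le_trans:
  assumes "rainbow_le H1 H2" "rainbow_le H2 H3"
  shows "rainbow_le H1 H3"
proof -
  obtain s where s: "s > 0" "\<And>(G :: nat ugraph) c. complete_graph G \<Longrightarrow> card (c ` edges G) \<ge> s \<Longrightarrow>
      rainbow_free H1 G c \<Longrightarrow> rainbow_free H2 G c"
    using assms(1) unfolding rainbow_le_def by blast
  obtain t where t: "t > 0" "\<And>(G :: nat ugraph) c. complete_graph G \<Longrightarrow> card (c ` edges G) \<ge> t \<Longrightarrow>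
      rainbow_free H2 G c \<Longrightarrow> rainbow_free H3 G c"
    using assms(2) unfolding rainbow_le_def by blast
  show ?thesis
    unfolding rainbow_le_def
  proof (intro exI conjI allI impI)
    show "max s t > 0"
      using s(1) by simp
  next
    fix G :: "nat ugraph" and c
    assume G: "complete_graph G" "card (c ` edges G) \<ge> max s t" "rainbow_free H1 G c"
    have "rainbow_free H2 G c"
      by (rule s(2)) (use G in simp_all)
    then show "rainbow_free H3 G c"
      by (intro t(2)) (use G in simp_all)
  qed
qed

lemma equiv_rainbow_equiv: "equiv conn_graphs rainbow_equiv"
proof (rule equivI)
  show "trans rainbow_equiv"
    by (rule transI) (use rainbow_le_trans in \<open>unfold rainbow_equiv_def, blast\<close>)
qed (auto simp: rainbow_equiv_def refl_on_def sym_def rainbow_le_refl)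

lemma class_le_iff:
  assumes "A \<in> conn_graphs // rainbow_equiv" "B \<in> conn_graphs // rainbow_equiv"
    and "H1 \<in> A" "H2 \<in> B"
  shows "class_le A B \<longleftrightarrow> rainbow_le H1 H2"
proof
  assume "class_le A B"
  then obtain K1 K2 where K: "K1 \<in> A" "K2 \<in> B" "rainbow_le K1 K2"
    unfolding class_le_def by blast
  have "(H1, K1) \<in> rainbow_equiv" "(K2, H2) \<in> rainbow_equiv"
    using quotient_eq_iff[OF equiv_rainbow_equiv assms(1,1,3) K(1)]
      quotient_eq_iff[OF equiv_rainbow_equiv assms(2,2) K(2) assms(4)] by simp_all
  then have "rainbow_le H1 K1" "rainbow_le K2 H2"
    unfolding rainbow_equiv_def by simp_all
  then show "rainbow_le H1 H2"
    using K(3) rainbow_le_trans[of H1 K1 K2] rainbow_le_trans[of H1 K2 H2] by simp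
qed (use assms in \<open>auto simp: class_le_def\<close>)

lemma partial_order_class_le:
  "partial_order_on (conn_graphs // rainbow_equiv)
     {(A, B). A \<in> conn_graphs // rainbow_equiv \<and> B \<in> conn_graphs // rainbow_equiv \<and> class_le A B}"
  (is "partial_order_on ?Q ?r")
proof -
  have ne: "\<exists>H. H \<in> A" if "A \<in> ?Q" for A
    using in_quotient_imp_non_empty[OF equiv_rainbow_equiv that] by blast
  have refl: "class_le A A" if "A \<in> ?Q" for A
    using ne[OF that] rainbow_le_refl unfolding class_le_def by blast
  have trans: "class_le A C"
    if ABC: "A \<in> ?Q" "B \<in> ?Q" "C \<in> ?Q" "class_le A B" "class_le B C" for A B C
  proof -
    obtain H1 H2 H3 where H: "H1 \<in> A" "H2 \<in> B" "H3 \<in> C"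
      using ne[OF ABC(1)] ne[OF ABC(2)] ne[OF ABC(3)] by blast
    have "rainbow_le H1 H2" "rainbow_le H2 H3"
      using ABC H class_le_iff[of A B H1 H2] class_le_iff[of B C H2 H3] by simp_all
    then show ?thesis
      using H rainbow_le_trans[of H1 H2 H3] unfolding class_le_def by blast
  qed
  have antisym: "A = B"
    if AB: "A \<in> ?Q" "B \<in> ?Q" "class_le A B" "class_le B A" for A B
  proof -
    obtain H1 H2 where H: "H1 \<in> A" "H2 \<in> B"
      using ne[OF AB(1)] ne[OF AB(2)] by blast
    have "H1 \<in> conn_graphs" "H2 \<in> conn_graphs"
      using H in_quotient_imp_subset[OF equiv_rainbow_equiv AB(1)]
        in_quotient_imp_subset[OF equiv_rainbow_equiv AB(2)] by auto
    then have "(H1, H2) \<in> rainbow_equiv"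
      using AB H class_le_iff[of A B H1 H2] class_le_iff[of B A H2 H1]
      unfolding rainbow_equiv_def by simp
    then show ?thesis
      using quotient_eq_iff[OF equiv_rainbow_equiv AB(1,2) H] by simp
  qed
  show ?thesis
    unfolding partial_order_on_def preorder_on_def
  proof (intro conjI)
    show "?r \<subseteq> ?Q \<times> ?Q"
      by blast
    show "refl_on ?Q ?r"
      unfolding refl_on_def using refl by blast
    show "trans ?r"
      by (rule transI) (use trans in blast)
    show "antisym ?r"
      by (rule antisymI) (use antisym in blast)
  qed
qed

end

theory Submission imports Defs begin

text \<open>
  Without a rainbow \<open>K\<^sub>1\<^sub>,\<^sub>3\<close> no vertex sees three colors, and any two vertices see a common one. Sets of
  at most two colors that meet pairwise share an element as soon as there are four colors in all.
  So some color \<open>z\<close> is seen by every vertex, and edges of different colors other than \<open>z\<close> are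
  disjoint: a rainbow subgraph is a matching plus at most one edge of color \<open>z\<close>, and if it is
  connected it is a path on at most four vertices.

  For the converse, three colorings contain a rainbow \<open>K\<^sub>1\<^sub>,\<^sub>3\<close> and arbitrarily many colors. A
  background color together with a \<open>P\<^sub>3\<close> and a matching in distinct colors leaves only
  \<open>K\<^sub>1\<^sub>,\<^sub>3\<close>, its subdivision, the triangle and \<open>P\<^sub>5\<close>; coloring each edge by its smaller end excludes
  the triangle, and a rainbow star in a background color excludes \<open>P\<^sub>5\<close>.
\<close>

section \<open>Isomorphisms and rainbow copies\<close>

lemma isomorphic_trans:
  assumes "isomorphic G H" "isomorphic H K"
  shows "isomorphic G K"
proof -
  obtain f where f: "bij_betw f (verts G) (verts H)" "edges H = (\<lambda>e. f ` e) ` edges G"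
    using assms(1) unfolding isomorphic_def by blast
  obtain g where g: "bij_betw g (verts H) (verts K)" "edges K = (\<lambda>e. g ` e) ` edges H"
    using assms(2) unfolding isomorphic_def by blast
  have "bij_betw (g \<circ> f) (verts G) (verts K)"
    using f(1) g(1) by (rule bij_betw_trans)
  moreover have "edges K = (\<lambda>e. (g \<circ> f) ` e) ` edges G"
    using f(2) g(2) by (simp add: image_image image_comp)
  ultimately show ?thesis
    unfolding isomorphic_def by blast
qed

text \<open>Simplicity of \<open>G\<close> keeps every edge inside \<open>verts G\<close>, where the
  inverse of the bijection undoes its image.\<close>

lemma isomorphic_sym:
  assumes "simple_graph G" "isomorphic G H"
  shows "isomorphic H G"
proof -
  obtain f where f: "bij_betw f (verts G) (verts H)" "edges H = (\<lambda>e. f ` e) ` edges G"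
    using assms(2) unfolding isomorphic_def by blast
  let ?g = "inv_into (verts G) f"
  have "?g ` f ` e = e" if "e \<in> edges G" for e
    using assms(1) f(1) that inv_into_image_cancel[of f "verts G" e]
    unfolding simple_graph_def bij_betw_def by blast
  then have "edges G = (\<lambda>e. ?g ` e) ` edges H"
    unfolding f(2) image_image by simp
  then show ?thesis
    using bij_betw_inv_into[OF f(1)] unfolding isomorphic_def by blast
qed

lemma rainbow_free_isomorphic:
  assumes "simple_graph H" "isomorphic H K"
  shows "rainbow_free H G c \<longleftrightarrow> rainbow_free K G c"
  using isomorphic_trans[OF _ assms(2)] isomorphic_trans[OF _ isomorphic_sym[OF assms]]
  unfolding rainbow_free_def by blast

lemma complete_graph_edgeI:
  "complete_graph G \<Longrightarrow> u \<in> verts G \<Longrightarrow> v \<in> verts G \<Longrightarrow> u \<noteq> v \<Longrightarrow> {u, v} \<in> edges G"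
  unfolding complete_graph_def by blast

lemma simple_graph_edgeE:
  assumes "simple_graph G" "e \<in> edges G"
  obtains u v where "e = {u, v}" "u \<noteq> v" "u \<in> verts G" "v \<in> verts G"
proof -
  have e: "e \<subseteq> verts G" "card e = 2"
    using assms unfolding simple_graph_def by blast+
  from e(2) obtain u v where "e = {u, v}" "u \<noteq> v"
    unfolding card_2_iff by blast
  with e(1) show thesis
    using that by simp
qed

lemma simple_graph_edgeD:
  assumes "simple_graph G" "{u, v} \<in> edges G"
  shows "u \<noteq> v" "u \<in> verts G" "v \<in> verts G"
proof -
  have "{u, v} \<subseteq> verts G" "card {u, v} = 2"
    using assms unfolding simple_graph_def by blast+
  then show "u \<noteq> v" "u \<in> verts G" "v \<in> verts G"
    by (auto simp: card_insert_if split: if_splits)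
qed

lemma complete_graph_simple: "complete_graph G \<Longrightarrow> simple_graph G"
  unfolding complete_graph_def by blast

lemma complete_graph_image_edge:
  assumes "complete_graph G" "simple_graph H" "inj_on f (verts H)" "f ` verts H \<subseteq> verts G"
    and "e \<in> edges H"
  shows "f ` e \<in> edges G"
proof -
  obtain x y where "e = {x, y}" "x \<noteq> y" "x \<in> verts H" "y \<in> verts H"
    using simple_graph_edgeE[OF assms(2,5)] .
  then show ?thesis
    using assms(3,4) complete_graph_edgeI[OF assms(1), of "f x" "f y"] inj_on_eq_iff[OF assms(3)]
    by (simp add: image_subset_iff)
qed

text \<open>In a complete host every injection of the vertices of \<open>H\<close> carries edges to
  edges, so only the colors matter. From here on a rainbow copy is handled as such an injection
  \<open>f\<close>.\<close>

lemma rainbow_free_complete_iff: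
  assumes "complete_graph G" "simple_graph H"
  shows "rainbow_free H G c \<longleftrightarrow>
    \<not> (\<exists>f. inj_on f (verts H) \<and> f ` verts H \<subseteq> verts G \<and> inj_on (\<lambda>e. c (f ` e)) (edges H))"
    (is "_ \<longleftrightarrow> \<not> ?copy")
proof -
  have "?copy" if S: "subgraph S G" "isomorphic S H" "rainbow c S" for S
  proof -
    have "isomorphic H S"
      using S isomorphic_sym unfolding subgraph_def by blast
    then obtain f where f: "bij_betw f (verts H) (verts S)" "edges S = (\<lambda>e. f ` e) ` edges H"
      unfolding isomorphic_def by blast
    have "inj_on f (verts H)"
      using f(1) unfolding bij_betw_def by blast
    moreover have "edges H \<subseteq> Pow (verts H)"
      using assms(2) unfolding simple_graph_def by blast
    ultimately have inj: "inj_on (\<lambda>e. f ` e) (edges H)"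
      using inj_on_image_Pow inj_on_subset by metis
    have "inj_on (c \<circ> (\<lambda>e. f ` e)) (edges H)"
      using comp_inj_on[OF inj] S(3) f(2) unfolding rainbow_def by simp
    then show ?copy
      using f(1) S(1) unfolding bij_betw_def subgraph_def comp_def by (intro exI[of _ f]) simp
  qed
  moreover have "\<not> rainbow_free H G c"
    if f: "inj_on f (verts H)" "f ` verts H \<subseteq> verts G" "inj_on (\<lambda>e. c (f ` e)) (edges H)" for f
  proof -
    let ?S = "\<lparr>verts = f ` verts H, edges = (\<lambda>e. f ` e) ` edges H\<rparr>"
    have iso: "isomorphic H ?S"
      using f(1) unfolding isomorphic_def bij_betw_def by auto
    have "f ` e \<in> edges G \<and> f ` e \<subseteq> f ` verts H \<and> card (f ` e) = 2" if "e \<in> edges H" for e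
      using complete_graph_image_edge[OF assms f(1,2) that] that assms(2) f(1) card_image
        inj_on_subset unfolding simple_graph_def by (metis image_mono)
    then have "subgraph ?S G"
      using assms(2) f(2) unfolding subgraph_def simple_graph_def by simp blast
    moreover have "rainbow c ?S"
      using inj_on_imageI[of c "(`) f"] f(3) unfolding rainbow_def comp_def by simp
    ultimately show ?thesis
      using isomorphic_sym[OF assms(2) iso] unfolding rainbow_free_def by blast
  qed
  ultimately show ?thesis
    unfolding rainbow_free_def by blast
qed

section \<open>Stars and paths\<close>

lemma star_graph_3:
  "star_graph 3 = \<lparr>verts = {0, 1, 2, 3}, edges = {{0, 1}, {0, 2}, {0, 3}}\<rparr>"
proof -
  have "{0..3} = {0, 1, 2, 3 :: nat}" "{1..3} = {1, 2, 3 :: nat}"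
    by auto
  then show ?thesis
    unfolding star_graph_def by auto
qed

text \<open>The vertex 4 subdivides the leg to 1, so the long leg runs 0, 4, 1 and the short leaves
  are 2 and 3.\<close>

lemma star_plus_graph_3:
  "star_plus_graph 3 = \<lparr>verts = {0, 1, 2, 3, 4}, edges = {{0, 2}, {0, 3}, {0, 4}, {1, 4}}\<rparr>"
  unfolding star_plus_graph_def star_graph_3 subdivide_def by (auto simp: doubleton_eq_iff)

lemma simple_star_3: "simple_graph (star_graph 3)"
  unfolding star_graph_3 simple_graph_def by auto

lemma simple_star_plus_3: "simple_graph (star_plus_graph 3)"
  unfolding star_plus_graph_3 simple_graph_def by auto

lemma rainbow_free_star_3_iff:
  assumes "complete_graph G"
  shows "rainbow_free (star_graph 3) G c \<longleftrightarrow>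
    \<not> (\<exists>v x y z. {v, x, y, z} \<subseteq> verts G \<and> distinct [v, x, y, z] \<and>
         distinct [c {v, x}, c {v, y}, c {v, z}])"
    (is "_ \<longleftrightarrow> \<not> ?star")
proof -
  have "(\<exists>f. inj_on f (verts (star_graph 3)) \<and> f ` verts (star_graph 3) \<subseteq> verts G \<and>
      inj_on (\<lambda>e. c (f ` e)) (edges (star_graph 3))) \<longleftrightarrow> ?star" (is "?copy \<longleftrightarrow> _")
  proof
    assume ?copy
    then obtain f where f: "inj_on f (verts (star_graph 3))" "f ` verts (star_graph 3) \<subseteq> verts G"
      "inj_on (\<lambda>e. c (f ` e)) (edges (star_graph 3))"
      by blast
    have "{f 0, f 1, f 2, f 3} \<subseteq> verts G"
      using f(2) by (simp add: star_graph_3)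
    moreover have "distinct [f 0, f 1, f 2, f 3]"
      by (simp add: star_graph_3 inj_on_eq_iff[OF f(1)])
    moreover have "distinct [c {f 0, f 1}, c {f 0, f 2}, c {f 0, f 3}]"
      using inj_on_eq_iff[OF f(3), of "{0, 1}" "{0, 2}"] inj_on_eq_iff[OF f(3), of "{0, 1}" "{0, 3}"]
        inj_on_eq_iff[OF f(3), of "{0, 2}" "{0, 3}"]
      by (simp add: star_graph_3 doubleton_eq_iff)
    ultimately show ?star
      by (intro exI conjI)
  next
    assume ?star
    then obtain v x y z where "{v, x, y, z} \<subseteq> verts G" "distinct [v, x, y, z]"
      "distinct [c {v, x}, c {v, y}, c {v, z}]"
      by (elim exE conjE)
    then show ?copy
      by (intro exI[of _ "\<lambda>i. [v, x, y, z] ! i"])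
        (auto simp: star_graph_3 insert_Diff_if doubleton_eq_iff)
  qed
  then show ?thesis
    by (simp only: rainbow_free_complete_iff[OF assms simple_star_3])
qed

text \<open>The edge \<open>{x, w}\<close> extends the rainbow star to a subdivided star, which can
  only fail to be rainbow if this edge repeats a leg color.\<close>

lemma rainbow_free_star_plus_3D:
  assumes "complete_graph G" "rainbow_free (star_plus_graph 3) G c"
    and "{v, x, y, z, w} \<subseteq> verts G" "distinct [v, x, y, z, w]"
    and "distinct [c {v, x}, c {v, y}, c {v, z}]"
  shows "c {x, w} \<in> {c {v, x}, c {v, y}, c {v, z}}"
proof (rule ccontr)
  assume "\<not> ?thesis"
  \<comment> \<open>The list holds the images of 0 to 4: the center \<open>v\<close>, the end
    \<open>w\<close> of the long leg, the short leaves \<open>y\<close> and \<open>z\<close>, and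
    the subdividing vertex \<open>x\<close>.\<close>
  then have "inj_on (\<lambda>i. [v, w, y, z, x] ! i) (verts (star_plus_graph 3)) \<and>
      (\<lambda>i. [v, w, y, z, x] ! i) ` verts (star_plus_graph 3) \<subseteq> verts G \<and>
      inj_on (\<lambda>e. c ((\<lambda>i. [v, w, y, z, x] ! i) ` e)) (edges (star_plus_graph 3))"
    using assms(3-5) by (auto simp: star_plus_graph_3 insert_Diff_if doubleton_eq_iff insert_commute)
  then show False
    using assms(1,2) rainbow_free_complete_iff simple_star_plus_3 by blast
qed

lemma isomorphic_star_3I:
  assumes "verts H = {v, x, y, z}" "edges H = {{v, x}, {v, y}, {v, z}}" "distinct [v, x, y, z]"
  shows "isomorphic H (star_graph 3)"
proof -
  have "isomorphic (star_graph 3) H"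
    unfolding isomorphic_def bij_betw_def using assms
    by (intro exI[of _ "\<lambda>i. [v, x, y, z] ! i"])
      (auto simp: star_graph_3 insert_Diff_if doubleton_eq_iff)
  then show ?thesis
    by (rule isomorphic_sym[OF simple_star_3])
qed

lemma isomorphic_star_plus_3I:
  assumes "verts H = {v, x, y, z, w}" "edges H = {{v, x}, {v, y}, {v, z}, {x, w}}"
    and "distinct [v, x, y, z, w]"
  shows "isomorphic H (star_plus_graph 3)"
proof -
  have "isomorphic (star_plus_graph 3) H"
    unfolding isomorphic_def bij_betw_def using assms
    by (intro exI[of _ "\<lambda>i. [v, w, y, z, x] ! i"])
      (auto simp: star_plus_graph_3 insert_Diff_if doubleton_eq_iff)
  then show ?thesis
    by (rule isomorphic_sym[OF simple_star_plus_3])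
qed

section \<open>Paths, and why a vertex of degree three excludes them\<close>

lemma simple_path_graph: "simple_graph (path_graph k)"
  unfolding path_graph_def simple_graph_def by auto

lemma isomorphic_path_graphI:
  assumes "distinct xs" "verts H = set xs"
    and "edges H = {{xs ! i, xs ! Suc i} | i. Suc i < length xs}"
  shows "isomorphic H (path_graph (length xs))"
proof -
  have "bij_betw (\<lambda>i. xs ! i) {0..<length xs} (set xs)"
    using assms(1) by (intro bij_betw_nth) auto
  moreover have "edges H = (\<lambda>e. (!) xs ` e) ` edges (path_graph (length xs))"
  proof -
    have "edges (path_graph (length xs)) = (\<lambda>i. {i, Suc i}) ` {i. Suc i < length xs}"
      unfolding path_graph_def by auto
    moreover have "edges H = (\<lambda>i. {xs ! i, xs ! Suc i}) ` {i. Suc i < length xs}"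
      unfolding assms(3) by auto
    ultimately show ?thesis
      by (simp add: image_image)
  qed
  ultimately have "isomorphic (path_graph (length xs)) H"
    unfolding isomorphic_def path_graph_def assms(2) by auto
  then show ?thesis
    by (rule isomorphic_sym[OF simple_path_graph])
qed

text \<open>The three neighbors of \<open>v\<close> would be sent to three different numbers next to
  \<open>f v\<close>, but only its predecessor and successor are available.\<close>

lemma not_isomorphic_path_graph:
  assumes "simple_graph H" "{{v, x}, {v, y}, {v, z}} \<subseteq> edges H" "distinct [x, y, z]"
  shows "\<not> isomorphic H (path_graph k)"
proof
  assume "isomorphic H (path_graph k)"
  then obtain f where f: "inj_on f (verts H)" "edges (path_graph k) = (\<lambda>e. f ` e) ` edges H"
    unfolding isomorphic_def bij_betw_def by blast
  have nbr: "f u = Suc (f v) \<or> f v = Suc (f u)" if "{v, u} \<in> edges H" for u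
  proof -
    have "{f v, f u} \<in> edges (path_graph k)"
      using imageI[OF that, of "(`) f"] by (simp add: f(2))
    then show ?thesis
      unfolding path_graph_def by (auto simp: doubleton_eq_iff)
  qed
  have "{x, y, z} \<subseteq> verts H"
    using assms(2) simple_graph_edgeD(3)[OF assms(1), of v] by simp
  then have "f x \<noteq> f y" "f x \<noteq> f z" "f y \<noteq> f z"
    using assms(3) by (simp_all add: inj_on_eq_iff[OF f(1)])
  then show False
    using nbr[of x] nbr[of y] nbr[of z] assms(2) by simp linarith
qed

section \<open>Connected graphs\<close>

text \<open>A walk from \<open>u\<close> never leaves \<open>A\<close>, so connectivity makes
  \<open>A\<close> the whole vertex set. This is how graphs are identified below: guess the vertices
  and edges, then check that no edge leads out of the guess.\<close>

lemma connected_graph_closed: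
  assumes "connected_graph H" "u \<in> A" "u \<in> verts H" "F \<subseteq> edges H"
    and closed: "\<And>x y. x \<in> A \<Longrightarrow> {x, y} \<in> edges H \<Longrightarrow> y \<in> A \<and> {x, y} \<in> F"
    and A: "A \<subseteq> verts H"
  shows "verts H = A \<and> edges H = F"
proof -
  have simple: "simple_graph H"
    using assms(1) unfolding connected_graph_def by blast
  have reach: "v \<in> A" if "v \<in> verts H" for v
  proof -
    have "(u, v) \<in> {(x, y). {x, y} \<in> edges H}\<^sup>*"
      using assms(1,3) that unfolding connected_graph_def by blast
    then show ?thesis
      by induction (use assms(2) closed in auto)
  qed
  have "e \<in> F" if e: "e \<in> edges H" for e
  proof -
    obtain x y where "e = {x, y}" "x \<in> verts H"
      using simple_graph_edgeE[OF simple e] .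
    then show ?thesis
      using closed[of x y] reach[of x] e by simp
  qed
  then show ?thesis
    using reach A assms(4) by blast
qed

lemma connected_graphI:
  assumes "simple_graph H" "r \<in> verts H"
    and "\<And>v. v \<in> verts H \<Longrightarrow> (r, v) \<in> {(x, y). {x, y} \<in> edges H}\<^sup>*"
  shows "connected_graph H"
proof -
  have "sym {(x, y). {x, y} \<in> edges H}"
    by (auto simp: sym_def insert_commute)
  then have "sym ({(x, y). {x, y} \<in> edges H}\<^sup>*)"
    by (rule sym_rtrancl)
  then show ?thesis
    using assms rtrancl_trans symD unfolding connected_graph_def by (metis (no_types, lifting) empty_iff)
qed

lemma connected_graph_isomorphic:
  assumes "connected_graph G" "isomorphic G H" "simple_graph H"
  shows "connected_graph H"
proof -
  obtain f where f: "bij_betw f (verts G) (verts H)" "edges H = (\<lambda>e. f ` e) ` edges G"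
    using assms(2) unfolding isomorphic_def by blast
  obtain r where r: "r \<in> verts G"
    using assms(1) unfolding connected_graph_def by blast
  have step: "(f r, f v) \<in> {(x, y). {x, y} \<in> edges H}\<^sup>*"
    if "(r, v) \<in> {(x, y). {x, y} \<in> edges G}\<^sup>*" for v
    using that
  proof induction
    case (step y z)
    then have "{f y, f z} \<in> edges H"
      using imageI[of "{y, z}" "edges G" "(`) f"] by (simp add: f(2))
    then have "(f y, f z) \<in> {(x, y). {x, y} \<in> edges H}"
      by simp
    with step.IH show ?case
      by (rule rtrancl.rtrancl_into_rtrancl)
  qed simp
  show ?thesis
  proof (rule connected_graphI[OF assms(3)])
    show "f r \<in> verts H"
      using f(1) r unfolding bij_betw_def by blast
    fix v assume "v \<in> verts H"
    then obtain u where "u \<in> verts G" "v = f u"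
      using f(1) unfolding bij_betw_def by blast
    then show "(f r, v) \<in> {(x, y). {x, y} \<in> edges H}\<^sup>*"
      using step r assms(1) unfolding connected_graph_def by blast
  qed
qed

lemma connected_star_3: "connected_graph (star_graph 3)"
proof (rule connected_graphI[OF simple_star_3, of 0])
  fix v assume "v \<in> verts (star_graph 3)"
  then have "v = 0 \<or> {0, v} \<in> edges (star_graph 3)"
    unfolding star_graph_3 by auto
  then show "(0, v) \<in> {(x, y). {x, y} \<in> edges (star_graph 3)}\<^sup>*"
    by auto
qed (simp add: star_graph_3)

lemma connected_star_plus_3: "connected_graph (star_plus_graph 3)"
proof (rule connected_graphI[OF simple_star_plus_3, of 0])
  fix v assume "v \<in> verts (star_plus_graph 3)"
  then have "v = 0 \<or> (0, v) \<in> {(x, y). {x, y} \<in> edges (star_plus_graph 3)} \<or>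
      (0, 4) \<in> {(x, y). {x, y} \<in> edges (star_plus_graph 3)} \<and>
      (4, v) \<in> {(x, y). {x, y} \<in> edges (star_plus_graph 3)}"
    unfolding star_plus_graph_3 by auto
  then show "(0, v) \<in> {(x, y). {x, y} \<in> edges (star_plus_graph 3)}\<^sup>*"
  proof (elim disjE conjE)
    assume "(0, 4) \<in> {(x, y). {x, y} \<in> edges (star_plus_graph 3)}"
      "(4, v) \<in> {(x, y). {x, y} \<in> edges (star_plus_graph 3)}"
    then show ?thesis
      by (rule rtrancl_into_rtrancl[OF r_into_rtrancl])
  qed (simp, rule r_into_rtrancl)
qed (simp add: star_plus_graph_3)

lemma conn_graphsI_star:
  assumes "simple_graph H" "isomorphic H (star_graph 3) \<or> isomorphic H (star_plus_graph 3)"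
  shows "H \<in> conn_graphs"
proof -
  have star: "\<not> isomorphic (star_graph 3) (path_graph k)" for k
    by (rule not_isomorphic_path_graph[OF simple_star_3, of 0 1 2 3]) (simp_all add: star_graph_3)
  have star_plus: "\<not> isomorphic (star_plus_graph 3) (path_graph k)" for k
    by (rule not_isomorphic_path_graph[OF simple_star_plus_3, of 0 2 3 4])
      (simp_all add: star_plus_graph_3)
  have "isomorphic (star_graph 3) H \<or> isomorphic (star_plus_graph 3) H"
    using isomorphic_sym[OF assms(1)] assms(2) by blast
  then have "connected_graph H" "\<not> isomorphic H (path_graph k)" for k
    using connected_graph_isomorphic[OF connected_star_3 _ assms(1)]
      connected_graph_isomorphic[OF connected_star_plus_3 _ assms(1)]
      isomorphic_trans[of _ H "path_graph k"] star[of k] star_plus[of k] by blast+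
  then show ?thesis
    unfolding conn_graphs_def by blast
qed

section \<open>Graphs that are almost matchings\<close>

lemma isomorphic_path_graph_small:
  shows "verts H = {a} \<Longrightarrow> edges H = {} \<Longrightarrow> isomorphic H (path_graph 1)"
    and "verts H = {a, b} \<Longrightarrow> edges H = {{a, b}} \<Longrightarrow> distinct [a, b] \<Longrightarrow> isomorphic H (path_graph 2)"
    and "verts H = {a, b, d} \<Longrightarrow> edges H = {{a, b}, {b, d}} \<Longrightarrow> distinct [a, b, d] \<Longrightarrow>
      isomorphic H (path_graph 3)"
    and "verts H = {a, b, d, x} \<Longrightarrow> edges H = {{a, b}, {b, d}, {d, x}} \<Longrightarrow> distinct [a, b, d, x] \<Longrightarrow>
      isomorphic H (path_graph 4)"
proof -
  have *: "{g i | i. i < n} = g ` {..<n}" for n and g :: "nat \<Rightarrow> 'a set"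
    by auto
  show "verts H = {a} \<Longrightarrow> edges H = {} \<Longrightarrow> isomorphic H (path_graph 1)"
    using isomorphic_path_graphI[of "[a]" H] by simp
  show "verts H = {a, b} \<Longrightarrow> edges H = {{a, b}} \<Longrightarrow> distinct [a, b] \<Longrightarrow> isomorphic H (path_graph 2)"
    using isomorphic_path_graphI[of "[a, b]" H] by (simp add: * lessThan_Suc numeral_2_eq_2)
  show "verts H = {a, b, d} \<Longrightarrow> edges H = {{a, b}, {b, d}} \<Longrightarrow> distinct [a, b, d] \<Longrightarrow>
      isomorphic H (path_graph 3)"
    using isomorphic_path_graphI[of "[a, b, d]" H]
    by (simp add: * lessThan_Suc eval_nat_numeral insert_commute)
  show "verts H = {a, b, d, x} \<Longrightarrow> edges H = {{a, b}, {b, d}, {d, x}} \<Longrightarrow> distinct [a, b, d, x] \<Longrightarrow>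
      isomorphic H (path_graph 4)"
    using isomorphic_path_graphI[of "[a, b, d, x]" H]
    by (simp add: * lessThan_Suc eval_nat_numeral insert_commute)
qed

text \<open>Injectivity of \<open>k\<close> leaves at most one edge of color \<open>z\<close>, and
  all other edges form a matching. A connected graph of this kind is a single vertex, a single edge,
  or the \<open>z\<close>-edge prolonged by at most one matching edge at each end.\<close>

lemma matching_plus_edge_is_path:
  assumes conn: "connected_graph H" and inj: "inj_on k (edges H)"
    and disj: "\<And>e e'. e \<in> edges H \<Longrightarrow> e' \<in> edges H \<Longrightarrow> e \<noteq> e' \<Longrightarrow> k e \<noteq> z \<Longrightarrow> k e' \<noteq> z \<Longrightarrow>
      e \<inter> e' = {}"
  shows "\<exists>i\<in>{1, 2, 3, 4}. isomorphic H (path_graph i)"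
proof -
  have simple: "simple_graph H"
    using conn unfolding connected_graph_def by blast
  note edgeD = simple_graph_edgeD[OF simple]
  have uniq: "x = y"
    if "{u, x} \<in> edges H" "{u, y} \<in> edges H" "k {u, x} \<noteq> z" "k {u, y} \<noteq> z" for u x y
    using disj[OF that(1,2) _ that(3,4)] by (auto simp: doubleton_eq_iff)
  show ?thesis
  proof (cases "\<exists>u v. {u, v} \<in> edges H \<and> k {u, v} = z")
    case True
    then obtain u v where uv: "{u, v} \<in> edges H" "k {u, v} = z"
      by blast
    have nz: "k e \<noteq> z" if "e \<in> edges H" "e \<noteq> {u, v}" for e
      using inj_onD[OF inj _ that(1) uv(1)] that(2) uv(2) by auto
    \<comment> \<open>Since \<open>{u, v}\<close> is the only edge of color \<open>z\<close>, each
      of its ends has at most one further neighbor, and every other vertex has at most one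
      neighbor.\<close>
    have pu: "w = x" if "{u, x} \<in> edges H" "x \<noteq> v" "{u, w} \<in> edges H" "w \<noteq> v" for x w
      using uniq[OF that(1,3)] nz that by (auto simp: doubleton_eq_iff)
    have pv: "w = x" if "{v, x} \<in> edges H" "x \<noteq> u" "{v, w} \<in> edges H" "w \<noteq> u" for x w
      using uniq[OF that(1,3)] nz that by (auto simp: doubleton_eq_iff)
    have px: "w = w'" if "x \<noteq> u" "x \<noteq> v" "{x, w} \<in> edges H" "{x, w'} \<in> edges H" for x w w'
      using uniq[OF that(3,4)] nz that by (auto simp: doubleton_eq_iff)
    show ?thesis
    proof (cases "\<exists>x. {u, x} \<in> edges H \<and> x \<noteq> v")
      case True
      then obtain x where x: "{u, x} \<in> edges H" "x \<noteq> v"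
        by blast
      have xu: "{x, u} \<in> edges H"
        using x(1) by (simp add: insert_commute)
      show ?thesis
      proof (cases "\<exists>y. {v, y} \<in> edges H \<and> y \<noteq> u")
        case True
        then obtain y where y: "{v, y} \<in> edges H" "y \<noteq> u"
          by blast
        have yv: "{y, v} \<in> edges H"
          using y(1) by (simp add: insert_commute)
        \<comment> \<open>Otherwise \<open>x\<close> would have the two neighbors \<open>u\<close>
          and \<open>v\<close>, contrary to \<open>px\<close>.\<close>
        have "x \<noteq> y"
          using px[of x u v] xu yv x(2) edgeD(1)[OF x(1)] edgeD(1)[OF uv(1)] by auto
        then have d: "distinct [x, u, v, y]"
          using x(2) y(2) edgeD(1)[OF uv(1)] edgeD(1)[OF x(1)] edgeD(1)[OF y(1)] by auto
        have "verts H = {x, u, v, y} \<and> edges H = {{x, u}, {u, v}, {v, y}}"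
        proof (rule connected_graph_closed[OF conn, of u])
          fix r s assume "r \<in> {x, u, v, y}" "{r, s} \<in> edges H"
          then show "s \<in> {x, u, v, y} \<and> {r, s} \<in> {{x, u}, {u, v}, {v, y}}"
            using pu[OF x, of s] pv[OF y, of s] px[OF _ _ xu, of s] px[OF _ _ yv, of s] d
            by (auto simp: doubleton_eq_iff)
        qed (use xu uv(1) y(1) edgeD[OF xu] edgeD[OF uv(1)] edgeD[OF y(1)] in auto)
        then show ?thesis
          using isomorphic_path_graph_small(4)[of H x u v y] d by blast
      next
        case False
        have d: "distinct [x, u, v]"
          using x(2) edgeD(1)[OF uv(1)] edgeD(1)[OF x(1)] by auto
        have "verts H = {x, u, v} \<and> edges H = {{x, u}, {u, v}}"
        proof (rule connected_graph_closed[OF conn, of u])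
          fix r s assume "r \<in> {x, u, v}" "{r, s} \<in> edges H"
          then show "s \<in> {x, u, v} \<and> {r, s} \<in> {{x, u}, {u, v}}"
            using pu[OF x, of s] False px[OF _ _ xu, of s] d
            by (auto simp: doubleton_eq_iff)
        qed (use xu uv(1) edgeD[OF xu] edgeD[OF uv(1)] in auto)
        then show ?thesis
          using isomorphic_path_graph_small(3)[of H x u v] d by blast
      qed
    next
      case nx: False
      show ?thesis
      proof (cases "\<exists>y. {v, y} \<in> edges H \<and> y \<noteq> u")
        case True
        then obtain y where y: "{v, y} \<in> edges H" "y \<noteq> u"
          by blast
        have yv: "{y, v} \<in> edges H"
          using y(1) by (simp add: insert_commute)
        have d: "distinct [u, v, y]"
          using y(2) edgeD(1)[OF uv(1)] edgeD(1)[OF y(1)] by auto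
        have "verts H = {u, v, y} \<and> edges H = {{u, v}, {v, y}}"
        proof (rule connected_graph_closed[OF conn, of u])
          fix r s assume "r \<in> {u, v, y}" "{r, s} \<in> edges H"
          then show "s \<in> {u, v, y} \<and> {r, s} \<in> {{u, v}, {v, y}}"
            using nx pv[OF y, of s] px[OF _ _ yv, of s] d
            by (auto simp: doubleton_eq_iff)
        qed (use uv(1) y(1) edgeD[OF uv(1)] edgeD[OF y(1)] in auto)
        then show ?thesis
          using isomorphic_path_graph_small(3)[of H u v y] d by blast
      next
        case False
        have "verts H = {u, v} \<and> edges H = {{u, v}}"
        proof (rule connected_graph_closed[OF conn, of u])
          fix r s assume "r \<in> {u, v}" "{r, s} \<in> edges H"
          then show "s \<in> {u, v} \<and> {r, s} \<in> {{u, v}}"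
            using nx False by (auto simp: doubleton_eq_iff)
        qed (use uv(1) edgeD[OF uv(1)] in auto)
        then show ?thesis
          using isomorphic_path_graph_small(2)[of H u v] edgeD(1)[OF uv(1)] by simp
      qed
    qed
  next
    case False
    \<comment> \<open>Without color \<open>z\<close> the whole graph is a matching.\<close>
    then have px: "w = w'" if "{x, w} \<in> edges H" "{x, w'} \<in> edges H" for x w w'
      using uniq that by blast
    obtain u where u: "u \<in> verts H"
      using conn unfolding connected_graph_def by blast
    show ?thesis
    proof (cases "\<exists>v. {u, v} \<in> edges H")
      case True
      then obtain v where uv: "{u, v} \<in> edges H"
        by blast
      then have vu: "{v, u} \<in> edges H"
        by (simp add: insert_commute)
      have "verts H = {u, v} \<and> edges H = {{u, v}}"
      proof (rule connected_graph_closed[OF conn, of u])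
        fix r s assume "r \<in> {u, v}" "{r, s} \<in> edges H"
        then show "s \<in> {u, v} \<and> {r, s} \<in> {{u, v}}"
          using px[OF uv, of s] px[OF vu, of s] by (auto simp: doubleton_eq_iff)
      qed (use uv edgeD[OF uv] in auto)
      then show ?thesis
        using isomorphic_path_graph_small(2)[of H u v] edgeD(1)[OF uv] by simp
    next
      case False
      have "verts H = {u} \<and> edges H = {}"
        by (rule connected_graph_closed[OF conn, of u]) (use u False in auto)
      then show ?thesis
        using isomorphic_path_graph_small(1)[of H u] by simp
    qed
  qed
qed

text \<open>The edge \<open>{x, y}\<close> is the only link from the path \<open>b\<close>,
  \<open>a\<close>, \<open>d\<close> to the rest, and beyond \<open>y\<close> at most one matching
  edge follows. Attached at the center \<open>a\<close> this gives the star or its subdivision;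
  attached at the end \<open>b\<close> it gives a path on four vertices, which is excluded, or one
  on five. The end \<open>d\<close> is covered by exchanging \<open>b\<close> and
  \<open>d\<close>.\<close>

lemma path3_pendant_cases:
  assumes conn: "connected_graph H" and inj: "inj_on k (edges H)"
    and ab: "{a, b} \<in> edges H" and ad: "{a, d} \<in> edges H" and bd: "b \<noteq> d"
    and col: "k {a, b} \<noteq> z" "k {a, d} \<noteq> z"
    and near: "\<And>g. g \<in> edges H \<Longrightarrow> g \<noteq> {a, b} \<Longrightarrow> g \<noteq> {a, d} \<Longrightarrow> k g \<noteq> z \<Longrightarrow> g \<inter> {a, b, d} = {}"
    and far: "\<And>g g'. g \<in> edges H \<Longrightarrow> g' \<in> edges H \<Longrightarrow> g \<noteq> g' \<Longrightarrow> k g \<noteq> z \<Longrightarrow> k g' \<noteq> z \<Longrightarrow>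
      g \<inter> {a, b, d} = {} \<Longrightarrow> g' \<inter> {a, b, d} = {} \<Longrightarrow> g \<inter> g' = {}"
    and xy: "{x, y} \<in> edges H" "k {x, y} = z" "x \<in> {a, b}" "y \<notin> {a, b, d}"
    and no_path: "\<not> isomorphic H (path_graph 4)"
  shows "isomorphic H (star_graph 3) \<or> isomorphic H (star_plus_graph 3) \<or>
    (\<exists>p q r s t. distinct [p, q, r, s, t] \<and> {{p, q}, {q, r}, {r, s}, {s, t}} \<subseteq> edges H)"
proof -
  have simple: "simple_graph H"
    using conn unfolding connected_graph_def by blast
  note edgeD = simple_graph_edgeD[OF simple]
  have d: "distinct [a, b, d, y]"
    using bd xy(4) edgeD(1)[OF ab] edgeD(1)[OF ad] by auto
  have nz: "k e \<noteq> z" if "e \<in> edges H" "e \<noteq> {x, y}" for e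
    using inj_onD[OF inj _ that(1) xy(1)] that(2) xy(2) by auto
  \<comment> \<open>Any further edge at \<open>a\<close>, \<open>b\<close> or \<open>d\<close> would
    have a color other than \<open>z\<close>, and \<open>near\<close> keeps such edges away.\<close>
  have core: "{r, s} \<in> {{a, b}, {a, d}, {x, y}}" if "r \<in> {a, b, d}" "{r, s} \<in> edges H" for r s
    using near[OF that(2)] nz[OF that(2)] that(1) by blast
  show ?thesis
  proof (cases "\<exists>w. {y, w} \<in> edges H \<and> w \<noteq> x")
    case True
    then obtain w where w: "{y, w} \<in> edges H" "w \<noteq> x"
      by blast
    have far_edge: "{y, s} \<inter> {a, b, d} = {} \<and> k {y, s} \<noteq> z" if "{y, s} \<in> edges H" "s \<noteq> x" for s
    proof -
      have "k {y, s} \<noteq> z"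
        using nz[OF that(1)] that(2) edgeD(1)[OF that(1)] by (auto simp: doubleton_eq_iff)
      then show ?thesis
        using near[OF that(1)] d by (auto simp: doubleton_eq_iff)
    qed
    have wd: "distinct [a, b, d, y, w]"
      using far_edge[OF w] d edgeD(1)[OF w(1)] by auto
    \<comment> \<open>By \<open>far\<close>, \<open>{y, w}\<close> is the only matching edge at
      \<open>y\<close>, and likewise at \<open>w\<close>, so the graph ends at
      \<open>w\<close>.\<close>
    have ny: "s \<in> {x, w}" if s: "{y, s} \<in> edges H" for s
      using far[OF s w(1)] far_edge[OF w] far_edge[OF s] by (auto simp: doubleton_eq_iff)
    have nw: "s = y" if s: "{w, s} \<in> edges H" for s
    proof -
      have *: "k {w, s} \<noteq> z"
        using nz[OF s] wd xy(3) by (auto simp: doubleton_eq_iff)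
      moreover have "{w, s} \<inter> {a, b, d} = {}"
        using near[OF s _ _ *] wd by (auto simp: doubleton_eq_iff)
      ultimately show ?thesis
        using far[OF s w(1)] far_edge[OF w] by (auto simp: doubleton_eq_iff)
    qed
    show ?thesis
    proof (cases "x = a")
      case True
      have "verts H = {a, y, b, d, w} \<and> edges H = {{a, y}, {a, b}, {a, d}, {y, w}}"
      proof (rule connected_graph_closed[OF conn, of a])
        fix r s assume "r \<in> {a, y, b, d, w}" "{r, s} \<in> edges H"
        then show "s \<in> {a, y, b, d, w} \<and> {r, s} \<in> {{a, y}, {a, b}, {a, d}, {y, w}}"
          using core[of r s] ny[of s] nw[of s] True by (auto simp: doubleton_eq_iff)
      qed (use True ab ad xy(1) w(1) edgeD[OF ab] edgeD[OF ad] edgeD[OF xy(1)] edgeD[OF w(1)] in auto)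
      then show ?thesis
        using isomorphic_star_plus_3I[of H a y b d w] wd by auto
    next
      case False
      then have "x = b"
        using xy(3) by simp
      then have "distinct [d, a, b, y, w]" "{{d, a}, {a, b}, {b, y}, {y, w}} \<subseteq> edges H"
        using wd ab ad xy(1) w(1) by (auto simp: insert_commute)
      then show ?thesis
        by blast
    qed
  next
    case no_w: False
    show ?thesis
    proof (cases "x = a")
      case True
      have "verts H = {a, b, d, y} \<and> edges H = {{a, b}, {a, d}, {a, y}}"
      proof (rule connected_graph_closed[OF conn, of a])
        fix r s assume "r \<in> {a, b, d, y}" "{r, s} \<in> edges H"
        then show "s \<in> {a, b, d, y} \<and> {r, s} \<in> {{a, b}, {a, d}, {a, y}}"
          using core[of r s] no_w True by (auto simp: doubleton_eq_iff)
      qed (use True ab ad xy(1) edgeD[OF ab] edgeD[OF ad] edgeD[OF xy(1)] in auto)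
      then show ?thesis
        using isomorphic_star_3I[of H a b d y] d by auto
    next
      case False
      then have x: "x = b"
        using xy(3) by simp
      have "verts H = {d, a, b, y} \<and> edges H = {{d, a}, {a, b}, {b, y}}"
      proof (rule connected_graph_closed[OF conn, of a])
        fix r s assume "r \<in> {d, a, b, y}" "{r, s} \<in> edges H"
        then show "s \<in> {d, a, b, y} \<and> {r, s} \<in> {{d, a}, {a, b}, {b, y}}"
          using core[of r s] no_w x by (auto simp: doubleton_eq_iff)
      qed (use x ab ad xy(1) edgeD[OF ab] edgeD[OF ad] edgeD[OF xy(1)] in \<open>auto simp: insert_commute\<close>)
      then show ?thesis
        using isomorphic_path_graph_small(4)[of H d a b y] d no_path by auto
    qed
  qed
qed

text \<open>\<open>z\<close> is a background color, and \<open>p\<close> and \<open>q\<close> are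
  the colors of the two edges of a path on three vertices: deleting \<open>z\<close> together with
  either of them leaves a matching. Hence two edges that meet outside \<open>z\<close> have exactly
  the colors \<open>p\<close> and \<open>q\<close>, and the rest of \<open>H\<close> is determined
  by where the \<open>z\<close>-edge lies.\<close>

lemma path3_matching_plus_edge_cases:
  assumes conn: "connected_graph H" and inj: "inj_on k (edges H)" and "p \<noteq> q"
    and p: "\<And>e e'. e \<in> edges H \<Longrightarrow> e' \<in> edges H \<Longrightarrow> e \<noteq> e' \<Longrightarrow> k e \<notin> {z, p} \<Longrightarrow> k e' \<notin> {z, p} \<Longrightarrow>
      e \<inter> e' = {}"
    and q: "\<And>e e'. e \<in> edges H \<Longrightarrow> e' \<in> edges H \<Longrightarrow> e \<noteq> e' \<Longrightarrow> k e \<notin> {z, q} \<Longrightarrow> k e' \<notin> {z, q} \<Longrightarrow>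
      e \<inter> e' = {}"
    and no_path: "\<not> (\<exists>i\<in>{1, 2, 3, 4}. isomorphic H (path_graph i))"
  shows "isomorphic H (star_graph 3) \<or> isomorphic H (star_plus_graph 3) \<or>
    (\<exists>x y z. distinct [x, y, z] \<and> {{x, y}, {x, z}, {y, z}} \<subseteq> edges H) \<or>
    (\<exists>p q r s t. distinct [p, q, r, s, t] \<and> {{p, q}, {q, r}, {r, s}, {s, t}} \<subseteq> edges H)"
proof -
  have simple: "simple_graph H"
    using conn unfolding connected_graph_def by blast
  note edgeD = simple_graph_edgeD[OF simple]
  \<comment> \<open>If no two edges outside \<open>z\<close> met, \<open>H\<close> would be a path
    on at most four vertices.\<close>
  have "\<exists>e e'. e \<in> edges H \<and> e' \<in> edges H \<and> e \<noteq> e' \<and> k e \<noteq> z \<and> k e' \<noteq> z \<and> e \<inter> e' \<noteq> {}"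
    using matching_plus_edge_is_path[OF conn inj, of z] no_path by blast
  \<comment> \<open>Deleting \<open>p\<close> must destroy the intersecting pair, so one of the two
    edges has color \<open>p\<close>; in the same way one has color \<open>q\<close>.\<close>
  then obtain e e' where e: "e \<in> edges H" "e' \<in> edges H" "k e = p" "k e' = q"
    "k e \<noteq> z" "k e' \<noteq> z" "e \<inter> e' \<noteq> {}"
    using p q \<open>p \<noteq> q\<close> by (metis Int_commute insert_iff singletonD)
  then obtain a where a: "a \<in> e" "a \<in> e'"
    by blast
  obtain b where b: "e = {a, b}"
    using simple_graph_edgeE[OF simple e(1)] a(1) by (metis insert_commute insertE singletonD)
  obtain d where d: "e' = {a, d}"
    using simple_graph_edgeE[OF simple e(2)] a(2) by (metis insert_commute insertE singletonD)
  have bd: "b \<noteq> d"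
    using e(3,4) b d \<open>p \<noteq> q\<close> by auto
  \<comment> \<open>Such a \<open>g\<close> has neither color \<open>p\<close> nor \<open>q\<close>.
    Deleting \<open>p\<close> compares it with \<open>e'\<close>, deleting \<open>q\<close> with
    \<open>e\<close>.\<close>
  have near: "g \<inter> {a, b, d} = {}" if g: "g \<in> edges H" "g \<noteq> {a, b}" "g \<noteq> {a, d}" "k g \<noteq> z" for g
  proof -
    have "k g \<noteq> p" "k g \<noteq> q"
      using inj_onD[OF inj _ g(1) e(1)] inj_onD[OF inj _ g(1) e(2)] e(3,4) b d g(2,3) by auto
    then have "g \<inter> e' = {}" "g \<inter> e = {}"
      using p[OF g(1) e(2)] q[OF g(1) e(1)] e b d g \<open>p \<noteq> q\<close> by auto
    then show ?thesis
      using b d by auto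
  qed
  have far: "g \<inter> g' = {}"
    if g: "g \<in> edges H" "g' \<in> edges H" "g \<noteq> g'" "k g \<noteq> z" "k g' \<noteq> z"
      "g \<inter> {a, b, d} = {}" "g' \<inter> {a, b, d} = {}" for g g'
  proof -
    have "k g \<noteq> p" "k g' \<noteq> p"
      using inj_onD[OF inj _ g(1) e(1)] inj_onD[OF inj _ g(2) e(1)] e(3) b g(6,7) by auto
    then show ?thesis
      using p[OF g(1-3)] g(4,5) by simp
  qed
  have E: "{a, b} \<in> edges H" "{a, d} \<in> edges H" "k {a, b} \<noteq> z" "k {a, d} \<noteq> z"
    using e b d by auto
  have abd: "distinct [a, b, d]"
    using bd edgeD(1)[OF E(1)] edgeD(1)[OF E(2)] by simp
  show ?thesis
  proof (cases "\<exists>x y. {x, y} \<in> edges H \<and> k {x, y} = z \<and> x \<in> {a, b, d}")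
    case True
    then obtain x y where xy: "{x, y} \<in> edges H" "k {x, y} = z" "x \<in> {a, b, d}"
      by blast
    show ?thesis
    proof (cases "y \<in> {a, b, d}")
      case True
      \<comment> \<open>The other two pairs within \<open>{a, b, d}\<close> are edges of colors
        different from \<open>z\<close>, so the \<open>z\<close>-edge closes a triangle.\<close>
      then have "{x, y} = {b, d}"
        using xy E(3,4) edgeD(1)[OF xy(1)] by (auto simp: insert_commute)
      then have "{{a, b}, {a, d}, {b, d}} \<subseteq> edges H"
        using xy(1) E by auto
      then show ?thesis
        using abd by blast
    next
      case False
      show ?thesis
      proof (cases "x = d")
        case True
        then show ?thesis
          using path3_pendant_cases[OF conn inj E(2,1) bd[symmetric] E(4,3) _ _ xy(1,2)]
            near far False no_path by (simp add: insert_commute) blast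
      next
        case x: False
        then show ?thesis
          using path3_pendant_cases[OF conn inj E(1,2) bd E(3,4) near far xy(1,2) _ False]
            xy(3) no_path by blast
      qed
    qed
  next
    case False
    \<comment> \<open>No \<open>z\<close>-edge touches the path \<open>b\<close>, \<open>a\<close>,
      \<open>d\<close>, so it is all of \<open>H\<close>.\<close>
    have "verts H = {b, a, d} \<and> edges H = {{b, a}, {a, d}}"
    proof (rule connected_graph_closed[OF conn, of a])
      fix r s assume rs: "r \<in> {b, a, d}" "{r, s} \<in> edges H"
      then have "{r, s} = {a, b} \<or> {r, s} = {a, d}"
        using near[OF rs(2)] False by blast
      then show "s \<in> {b, a, d} \<and> {r, s} \<in> {{b, a}, {a, d}}"
        by (auto simp: doubleton_eq_iff)
    qed (use E edgeD[OF E(1)] edgeD[OF E(2)] in \<open>auto simp: insert_commute\<close>)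
    then show ?thesis
      using isomorphic_path_graph_small(3)[of H b a d] abd no_path by auto
  qed
qed

section \<open>Colorings with a rainbow star\<close>

definition complete_on :: "nat \<Rightarrow> nat ugraph" where
  "complete_on n = \<lparr>verts = {0..<n}, edges = {e. e \<subseteq> {0..<n} \<and> card e = 2}\<rparr>"

lemma complete_graph_complete_on: "complete_graph (complete_on n)"
  unfolding complete_on_def complete_graph_def simple_graph_def by auto

lemma finite_edges: "simple_graph G \<Longrightarrow> finite (edges G)"
  unfolding simple_graph_def by (rule finite_subset[of _ "Pow (verts G)"]) auto

text \<open>A single coloring of all finite sets of naturals serves every bound \<open>t\<close>: only the order of
  the complete graph grows with \<open>t\<close>.\<close>

lemma rainbow_le_star_3_copy:
  fixes g :: "nat \<Rightarrow> nat set" and c :: "nat set \<Rightarrow> nat"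
  assumes le: "rainbow_le H (star_graph 3)" and simple: "simple_graph H"
    and g: "\<And>i. g i \<subseteq> {0..<2 * i + 3} \<and> card (g i) = 2" "inj (\<lambda>i. c (g i))"
    and star: "distinct [v, x, y, z]" "{v, x, y, z} \<subseteq> {0..<4}"
      "distinct [c {v, x}, c {v, y}, c {v, z}]"
  shows "\<exists>f. inj_on f (verts H) \<and> inj_on (\<lambda>e. c (f ` e)) (edges H)"
proof -
  obtain t where t: "\<And>(G :: nat ugraph) c. complete_graph G \<Longrightarrow> card (c ` edges G) \<ge> t \<Longrightarrow>
      rainbow_free H G c \<Longrightarrow> rainbow_free (star_graph 3) G c"
    using le unfolding rainbow_le_def by blast
  \<comment> \<open>The order is large enough for \<open>g i\<close> with \<open>i < t\<close>,
    which lies below \<open>2 * i + 3\<close>, and for the four vertices of the star, even when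
    \<open>t = 0\<close>.\<close>
  define G where "G = complete_on (2 * t + 4)"
  have G: "complete_graph G"
    unfolding G_def by (rule complete_graph_complete_on)
  have "g i \<in> edges G" if "i < t" for i
    using g(1)[of i] that unfolding G_def complete_on_def by fastforce
  then have "(\<lambda>i. c (g i)) ` {..<t} \<subseteq> c ` edges G"
    by blast
  moreover have "card ((\<lambda>i. c (g i)) ` {..<t}) = t"
    using card_image[OF inj_on_subset[OF g(2) subset_UNIV], of "{..<t}"] by simp
  ultimately have "t \<le> card (c ` edges G)"
    using card_mono finite_edges[OF complete_graph_simple[OF G]] finite_imageI by metis
  moreover have "{v, x, y, z} \<subseteq> verts G"
    using star(2) unfolding G_def complete_on_def by auto
  then have "\<not> rainbow_free (star_graph 3) G c"
    using star(1,3) rainbow_free_star_3_iff[OF G, of c] by blast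
  ultimately have "\<not> rainbow_free H G c"
    using t[OF G] by blast
  then show ?thesis
    using rainbow_free_complete_iff[OF G simple, of c] by blast
qed

text \<open>When edges are colored by their smaller end, the two edges of a triangle at its least
  vertex share a color.\<close>

lemma rainbow_le_star_3_no_triangle:
  assumes le: "rainbow_le H (star_graph 3)" and simple: "simple_graph H"
    and xyz: "distinct [x, y, z]" "{{x, y}, {x, z}, {y, z}} \<subseteq> edges H"
  shows False
proof -
  have "\<exists>f :: nat \<Rightarrow> nat. inj_on f (verts H) \<and> inj_on (\<lambda>e. Min (f ` e)) (edges H)"
    \<comment> \<open>The star with center 3 and leaves 0, 1, 2 is rainbow because its center is the
      largest vertex.\<close>
    by (rule rainbow_le_star_3_copy[OF le simple, of "\<lambda>i. {i, Suc i}" Min 3 0 1 2])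
      (auto simp: inj_def)
  then obtain f :: "nat \<Rightarrow> nat" where
    f: "inj_on f (verts H)" "inj_on (\<lambda>e. Min (f ` e)) (edges H)"
    by blast
  have E: "{x, y} \<in> edges H" "{x, z} \<in> edges H" "{y, z} \<in> edges H"
    using xyz(2) by auto
  have "Min {f x, f y} \<noteq> Min {f x, f z}" "Min {f x, f y} \<noteq> Min {f y, f z}"
    "Min {f x, f z} \<noteq> Min {f y, f z}"
    using inj_on_eq_iff[OF f(2) E(1,2)] inj_on_eq_iff[OF f(2) E(1,3)]
      inj_on_eq_iff[OF f(2) E(2,3)] xyz(1) by (simp_all add: doubleton_eq_iff)
  then show False
    by (simp add: min_def split: if_splits)
qed

text \<open>Every edge avoiding the vertex 0 gets the background color 0, so a rainbow copy has at
  most one such edge. Removing any single vertex from a path on five vertices leaves at least two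
  edges.\<close>

lemma rainbow_le_star_3_no_path_5:
  assumes le: "rainbow_le H (star_graph 3)" and simple: "simple_graph H"
    and path: "distinct [p, q, r, s, t]" "{{p, q}, {q, r}, {r, s}, {s, t}} \<subseteq> edges H"
  shows False
proof -
  \<comment> \<open>On an edge through 0, \<open>Max e\<close> is the other end; it is positive and
    so differs from the background color.\<close>
  define c :: "nat set \<Rightarrow> nat" where "c e = (if 0 \<in> e then Max e else 0)" for e
  have "\<exists>f. inj_on f (verts H) \<and> inj_on (\<lambda>e. c (f ` e)) (edges H)"
    by (rule rainbow_le_star_3_copy[OF le simple, of "\<lambda>i. {0, Suc i}" c 0 1 2 3])
      (auto simp: inj_def c_def)
  then obtain f where f: "inj_on f (verts H)" "inj_on (\<lambda>e. c (f ` e)) (edges H)"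
    by blast
  have E: "{p, q} \<in> edges H" "{q, r} \<in> edges H" "{r, s} \<in> edges H" "{s, t} \<in> edges H"
    using path(2) by auto
  have zero: "0 \<in> f ` e \<or> 0 \<in> f ` e'" if "e \<in> edges H" "e' \<in> edges H" "e \<noteq> e'" for e e'
    using inj_on_eq_iff[OF f(2) that(1,2)] that(3)
    by (cases "0 \<in> f ` e"; cases "0 \<in> f ` e'") (simp_all add: c_def)
  have V: "p \<in> verts H" "q \<in> verts H" "r \<in> verts H" "s \<in> verts H" "t \<in> verts H"
    using simple_graph_edgeD[OF simple E(1)] simple_graph_edgeD[OF simple E(3)]
      simple_graph_edgeD[OF simple E(4)] by auto
  have "distinct [f p, f q, f r, f s, f t]"
    using path(1) V by (simp add: inj_on_eq_iff[OF f(1)])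
  \<comment> \<open>These three pairs suffice: no vertex of the path meets an edge of each
    pair.\<close>
  moreover have "0 \<in> {f p, f q} \<or> 0 \<in> {f q, f r}" "0 \<in> {f p, f q} \<or> 0 \<in> {f s, f t}"
    "0 \<in> {f r, f s} \<or> 0 \<in> {f s, f t}"
    using zero[OF E(1,2)] zero[OF E(1,4)] zero[OF E(3,4)] path(1)
    by (simp_all add: doubleton_eq_iff)
  ultimately show False
    by (simp, metis)
qed

text \<open>The coloring with a path on three vertices and a matching over a background color forces
  \<open>H\<close> into one of four shapes; the triangle and the path on five vertices then fall to
  the two preceding colorings.\<close>

lemma rainbow_le_star_3_cases:
  assumes le: "rainbow_le H (star_graph 3)" and H: "H \<in> conn_graphs"
  shows "isomorphic H (star_graph 3) \<or> isomorphic H (star_plus_graph 3)"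
proof -
  have conn: "connected_graph H" and no_path: "\<not> (\<exists>i\<in>{1, 2, 3, 4}. isomorphic H (path_graph i))"
    using H unfolding conn_graphs_def by auto
  have simple: "simple_graph H"
    using conn unfolding connected_graph_def by blast
  \<comment> \<open>The path is 0, 1, 2 with colors 1 and 3, and the matching continues with
    \<open>{3, 4}\<close>, \<open>{5, 6}\<close> and so on. The offset 2 makes the colors of these
    pairs at least 3, apart from 0 and 1.\<close>
  define c :: "nat set \<Rightarrow> nat" where
    "c e = (if e = {0, 1} then 1 else if \<exists>i. e = {2 * i + 1, 2 * i + 2} then 2 + Min e else 0)" for e
  have c_pair: "c {2 * i + 1, 2 * i + 2} = 2 * i + 3" for i
    unfolding c_def by (auto simp: doubleton_eq_iff)
  have c_inj: "inj (\<lambda>i. c {2 * i + 1, 2 * i + 2})"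
    unfolding c_pair by (simp add: inj_def)
  \<comment> \<open>The rainbow star has center 1: one leg in each color of the path and one in the
    background color.\<close>
  have "c {1, 0} = 1"
    unfolding c_def by (simp add: insert_commute)
  moreover have "c {1, 2} = 3"
    using c_pair[of 0] by (simp add: numeral_2_eq_2)
  moreover have "c {1, 3} = 0"
    unfolding c_def by (auto simp: doubleton_eq_iff)
  ultimately have "\<exists>f. inj_on f (verts H) \<and> inj_on (\<lambda>e. c (f ` e)) (edges H)"
    using c_inj
    by (intro rainbow_le_star_3_copy[OF le simple, of "\<lambda>i. {2 * i + 1, 2 * i + 2}" c 1 0 2 3]) auto
  then obtain f where f: "inj_on f (verts H)" "inj_on (\<lambda>e. c (f ` e)) (edges H)"
    by blast
  have pair: "e = {0, 1} \<and> c e = 1 \<or> (\<exists>i. e = {2 * i + 1, 2 * i + 2} \<and> c e = 2 * i + 3)"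
    if "c e \<noteq> 0" for e
    using that c_pair unfolding c_def by (auto split: if_splits)
  have disj: "{2 * i + 1, 2 * i + 2} \<inter> {2 * j + 1, 2 * j + 2} = {}" if "i \<noteq> j" for i j :: nat
  proof -
    have "2 * i + 1 \<noteq> 2 * j + 2" "2 * i + 2 \<noteq> 2 * j + 1"
      by presburger+
    then show ?thesis
      using that by simp
  qed
  \<comment> \<open>Dropping color 1 removes \<open>{0, 1}\<close> and leaves the disjoint
    pairs.\<close>
  have c1: "e \<inter> e' = {}" if e: "c e \<notin> {0, 1}" "c e' \<notin> {0, 1}" "e \<noteq> e'" for e e'
  proof -
    have "\<exists>i. e = {2 * i + 1, 2 * i + 2}" if "c e \<notin> {0, 1}" for e
      using pair[of e] that by auto
    then obtain i j where "e = {2 * i + 1, 2 * i + 2}" "e' = {2 * j + 1, 2 * j + 2}"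
      using e(1,2) by blast
    then show ?thesis
      using disj[of i j] e(3) by blast
  qed
  \<comment> \<open>Dropping color 3 removes \<open>{1, 2}\<close>, the pair with
    \<open>i = 0\<close>; the remaining pairs avoid 0 and 1.\<close>
  have c3: "e \<inter> e' = {}" if e: "c e \<notin> {0, 3}" "c e' \<notin> {0, 3}" "e \<noteq> e'" for e e'
  proof -
    have "e = {0, 1} \<or> (\<exists>i. e = {2 * i + 1, 2 * i + 2} \<and> i \<noteq> 0)" if "c e \<notin> {0, 3}" for e
      using pair[of e] that by auto
    from this[OF e(1)] this[OF e(2)] show ?thesis
    proof (elim disjE exE conjE)
      fix i j assume "e = {2 * i + 1, 2 * i + 2}" "e' = {2 * j + 1, 2 * j + 2}"
      then show ?thesis
        using disj[of i j] e(3) by blast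
    qed (use e(3) in simp_all)
  qed
  have transfer: "e \<inter> e' = {}" if "f ` e \<inter> f ` e' = {}" for e e'
    using that by blast
  have ne: "f ` e \<noteq> f ` e'" if "e \<in> edges H" "e' \<in> edges H" "e \<noteq> e'" for e e'
    using inj_on_eq_iff[OF f(2) that(1,2)] that(3) by auto
  have "isomorphic H (star_graph 3) \<or> isomorphic H (star_plus_graph 3) \<or>
    (\<exists>x y z. distinct [x, y, z] \<and> {{x, y}, {x, z}, {y, z}} \<subseteq> edges H) \<or>
    (\<exists>p q r s t. distinct [p, q, r, s, t] \<and> {{p, q}, {q, r}, {r, s}, {s, t}} \<subseteq> edges H)"
  proof (rule path3_matching_plus_edge_cases[OF conn f(2), of 1 3 0])
    fix e e' assume e: "e \<in> edges H" "e' \<in> edges H" "e \<noteq> e'"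
    show "e \<inter> e' = {}" if "c (f ` e) \<notin> {0, 1}" "c (f ` e') \<notin> {0, 1}"
      using transfer[OF c1[OF that ne[OF e]]] .
    show "e \<inter> e' = {}" if "c (f ` e) \<notin> {0, 3}" "c (f ` e') \<notin> {0, 3}"
      using transfer[OF c3[OF that ne[OF e]]] .
  qed (use no_path in simp_all)
  then show ?thesis
  proof (elim disjE exE conjE)
    fix x y z assume "distinct [x, y, z]" "{{x, y}, {x, z}, {y, z}} \<subseteq> edges H"
    from rainbow_le_star_3_no_triangle[OF le simple this] show ?thesis ..
  next
    fix p q r s t assume "distinct [p, q, r, s, t]" "{{p, q}, {q, r}, {r, s}, {s, t}} \<subseteq> edges H"
    from rainbow_le_star_3_no_path_5[OF le simple this] show ?thesis ..
  qed simp_all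
qed

section \<open>Colorings without a rainbow star\<close>

text \<open>Without a common element, three of the sets are \<open>{p, q}\<close>,
  \<open>{q, r}\<close> and \<open>{p, r}\<close>. A set with at most two elements that meets all
  three lies in \<open>{p, q, r}\<close>, so there would be only three elements in all.\<close>

lemma common_element_of_intersecting_pairs:
  assumes "V \<noteq> {}" and small: "\<And>v x y w. v \<in> V \<Longrightarrow> {x, y, w} \<subseteq> C v \<Longrightarrow> \<not> distinct [x, y, w]"
    and meet: "\<And>u v. u \<in> V \<Longrightarrow> v \<in> V \<Longrightarrow> C u \<inter> C v \<noteq> {}"
    and card: "3 < card (\<Union>v\<in>V. C v)"
  shows "\<exists>z. \<forall>v\<in>V. z \<in> C v"
proof (rule ccontr)
  assume no: "\<not> ?thesis"
  obtain v where v: "v \<in> V"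
    using assms(1) by blast
  obtain p where p: "p \<in> C v"
    using meet[OF v v] by blast
  obtain u where u: "u \<in> V" "p \<notin> C u"
    using no by blast
  obtain q where q: "q \<in> C u" "q \<in> C v" "q \<noteq> p"
    using meet[OF u(1) v] u(2) by blast
  obtain w where w: "w \<in> V" "q \<notin> C w"
    using no by blast
  have Cv: "C v \<subseteq> {p, q}"
    using small[OF v, of p q] p q by auto
  then have pw: "p \<in> C w"
    using meet[OF w(1) v] w(2) by blast
  obtain r where r: "r \<in> C u" "r \<in> C w"
    using meet[OF u(1) w(1)] by blast
  have rpq: "r \<noteq> p" "r \<noteq> q"
    using r u(2) w(2) by auto
  have Cu: "C u \<subseteq> {q, r}"
    using small[OF u(1), of q r] q r rpq by auto
  have Cw: "C w \<subseteq> {p, r}"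
    using small[OF w(1), of p r] pw r rpq by auto
  have "C x \<subseteq> {p, q, r}" if x: "x \<in> V" for x
  proof -
    \<comment> \<open>A single one of the three elements misses one of the three pairs, so
      \<open>C x\<close> contains two of them, and \<open>small\<close> leaves no room for
      more.\<close>
    have "p \<in> C x \<and> q \<in> C x \<or> p \<in> C x \<and> r \<in> C x \<or> q \<in> C x \<and> r \<in> C x"
      using meet[OF x v] meet[OF x u(1)] meet[OF x w(1)] Cv Cu Cw by blast
    then show ?thesis
      using small[OF x, of p q] small[OF x, of p r] small[OF x, of q r] q(3) rpq by auto
  qed
  then have "(\<Union>v\<in>V. C v) \<subseteq> {p, q, r}"
    by blast
  then have "card (\<Union>v\<in>V. C v) \<le> card {p, q, r}"
    by (intro card_mono) auto
  also have "\<dots> \<le> 3"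
    by (simp add: card_insert_if)
  finally show False
    using card by simp
qed

text \<open>The preceding lemma is applied to the sets \<open>C v\<close> of colors seen at
  \<open>v\<close>. Two of them meet in the color of the edge joining the two vertices.\<close>

lemma rainbow_star_3_free_main_color:
  assumes G: "complete_graph G" and free: "rainbow_free (star_graph 3) G c"
    and card: "4 \<le> card (c ` edges G)"
  obtains z where "\<And>e e'. e \<in> edges G \<Longrightarrow> e' \<in> edges G \<Longrightarrow> c e \<noteq> z \<Longrightarrow> c e' \<noteq> z \<Longrightarrow>
    c e \<noteq> c e' \<Longrightarrow> e \<inter> e' = {}"
proof -
  have simple: "simple_graph G"
    by (rule complete_graph_simple[OF G])
  define C where "C v = {c {v, w} | w. {v, w} \<in> edges G}" for v
  have small: "\<not> distinct [i, j, l]" if C: "{i, j, l} \<subseteq> C v" for v i j l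
  proof
    assume d: "distinct [i, j, l]"
    obtain x y w where E: "{v, x} \<in> edges G" "{v, y} \<in> edges G" "{v, w} \<in> edges G"
      "i = c {v, x}" "j = c {v, y}" "l = c {v, w}"
      using C unfolding C_def by auto
    then have "distinct [c {v, x}, c {v, y}, c {v, w}]"
      using d by simp
    moreover from this have "distinct [v, x, y, w]" "{v, x, y, w} \<subseteq> verts G"
      using simple_graph_edgeD[OF simple E(1)] simple_graph_edgeD[OF simple E(2)]
        simple_graph_edgeD[OF simple E(3)] by auto
    ultimately show False
      using free rainbow_free_star_3_iff[OF G, of c] by blast
  qed
  have seen: "c e \<in> C v" if e: "e \<in> edges G" "v \<in> e" for e v
  proof -
    obtain p q where "e = {p, q}"
      using simple_graph_edgeE[OF simple e(1)] .
    then have "e = {v, p} \<or> e = {v, q}"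
      using e(2) by auto
    then show ?thesis
      using e(1) unfolding C_def by blast
  qed
  \<comment> \<open>An edge provides two vertices, so every vertex lies on some edge and
    \<open>C u\<close> is nonempty, which is the case \<open>u = v\<close> of
    \<open>meet\<close>.\<close>
  have "edges G \<noteq> {}"
    using card by auto
  then obtain e where "e \<in> edges G"
    by blast
  then obtain a b where ab: "a \<noteq> b" "a \<in> verts G" "b \<in> verts G"
    by (rule simple_graph_edgeE[OF simple])
  have meet: "C u \<inter> C v \<noteq> {}" if uv: "u \<in> verts G" "v \<in> verts G" for u v
  proof (cases "u = v")
    case True
    obtain w where "w \<in> verts G" "w \<noteq> u"
      using ab by (cases "a = u") auto
    then have "c {u, w} \<in> C u"
      using seen[of "{u, w}" u] complete_graph_edgeI[OF G uv(1), of w] by simp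
    then show ?thesis
      using True by blast
  next
    case False
    then have "c {u, v} \<in> C u" "c {u, v} \<in> C v"
      using seen[of "{u, v}"] complete_graph_edgeI[OF G uv] by simp_all
    then show ?thesis
      by blast
  qed
  have "c e \<in> (\<Union>v\<in>verts G. C v)" if e: "e \<in> edges G" for e
  proof -
    obtain p q where "e = {p, q}" "p \<in> verts G"
      using simple_graph_edgeE[OF simple e] .
    then show ?thesis
      using seen[OF e, of p] by blast
  qed
  moreover have "(\<Union>v\<in>verts G. C v) \<subseteq> c ` edges G"
    unfolding C_def by blast
  ultimately have "(\<Union>v\<in>verts G. C v) = c ` edges G"
    by blast
  then have "3 < card (\<Union>v\<in>verts G. C v)"
    using card by simp
  then obtain z where z: "\<And>v. v \<in> verts G \<Longrightarrow> z \<in> C v"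
    using common_element_of_intersecting_pairs[of "verts G" C] small meet ab(2) by blast
  show thesis
  proof (rule that[of z], rule ccontr)
    fix e e' assume e: "e \<in> edges G" "e' \<in> edges G" "c e \<noteq> z" "c e' \<noteq> z" "c e \<noteq> c e'"
      "e \<inter> e' \<noteq> {}"
    then obtain v where v: "v \<in> e" "v \<in> e'"
      by blast
    then have "v \<in> verts G"
      using simple e(1) unfolding simple_graph_def by blast
    \<comment> \<open>A common vertex of \<open>e\<close> and \<open>e'\<close> would see the three
      colors \<open>z\<close>, \<open>c e\<close> and \<open>c e'\<close>.\<close>
    then show False
      using small[of z "c e" "c e'" v] z seen[OF e(1) v(1)] seen[OF e(2) v(2)] e(3-5) by auto
  qed
qed

text \<open>In a rainbow copy of \<open>H\<close>, edges whose color is not the main color are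
  disjoint, so \<open>H\<close> would be a path on at most four vertices. The bound 4 is what the
  existence of a main color requires.\<close>

lemma star_3_rainbow_le:
  assumes "H \<in> conn_graphs"
  shows "rainbow_le (star_graph 3) H"
  unfolding rainbow_le_def
proof (intro exI[of _ 4] conjI allI impI, simp)
  fix G :: "nat ugraph" and c
  assume G: "complete_graph G" and card: "4 \<le> card (c ` edges G)"
    and free: "rainbow_free (star_graph 3) G c"
  have conn: "connected_graph H" and no_path: "\<not> (\<exists>i\<in>{1, 2, 3, 4}. isomorphic H (path_graph i))"
    using assms unfolding conn_graphs_def by auto
  have simple: "simple_graph H"
    using conn unfolding connected_graph_def by blast
  obtain z where z: "\<And>e e'. e \<in> edges G \<Longrightarrow> e' \<in> edges G \<Longrightarrow> c e \<noteq> z \<Longrightarrow> c e' \<noteq> z \<Longrightarrow>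
      c e \<noteq> c e' \<Longrightarrow> e \<inter> e' = {}"
    using rainbow_star_3_free_main_color[OF G free card] by blast
  show "rainbow_free H G c"
  proof (rule ccontr)
    assume "\<not> rainbow_free H G c"
    then obtain f where f: "inj_on f (verts H)" "f ` verts H \<subseteq> verts G"
      "inj_on (\<lambda>e. c (f ` e)) (edges H)"
      using rainbow_free_complete_iff[OF G simple, of c] by blast
    have "e \<inter> e' = {}"
      if "e \<in> edges H" "e' \<in> edges H" "e \<noteq> e'" "c (f ` e) \<noteq> z" "c (f ` e') \<noteq> z" for e e'
      using z[of "f ` e" "f ` e'"] complete_graph_image_edge[OF G simple f(1,2)]
        inj_on_eq_iff[OF f(3) that(1,2)] that by blast
    then show False
      using matching_plus_edge_is_path[OF conn f(3), of z] no_path by blast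
  qed
qed

text \<open>Let \<open>v\<close> be the center of a rainbow star with leaves \<open>x\<close> and \<open>y\<close>. All but three colors occur at
  \<open>v\<close>, so three of them differ from those of the legs to \<open>x\<close> and \<open>y\<close>. Taking any two of the three
  as the other legs shows that the color of \<open>{x, y}\<close> is one of these two, which is impossible.\<close>

lemma star_plus_3_rainbow_le: "rainbow_le (star_plus_graph 3) (star_graph 3)"
  unfolding rainbow_le_def
\<comment> \<open>8 counts three colors possibly missing at the center, two leg colors set aside,
  and three further colors at the center.\<close>
proof (intro exI[of _ 8] conjI allI impI, simp)
  fix G :: "nat ugraph" and c
  assume G: "complete_graph G" and card: "8 \<le> card (c ` edges G)"
    and free: "rainbow_free (star_plus_graph 3) G c"
  have simple: "simple_graph G"
    by (rule complete_graph_simple[OF G])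
  note pendant = rainbow_free_star_plus_3D[OF G free]
  show "rainbow_free (star_graph 3) G c"
  proof (rule ccontr)
    assume "\<not> rainbow_free (star_graph 3) G c"
    then obtain v x y z where V: "{v, x, y, z} \<subseteq> verts G" and d: "distinct [v, x, y, z]"
      and cd: "distinct [c {v, x}, c {v, y}, c {v, z}]"
      using rainbow_free_star_3_iff[OF G, of c] by blast
    define D where "D = {c {v, w} | w. w \<in> verts G - {v}}"
    have fin: "finite D"
      using simple unfolding D_def simple_graph_def by auto
    have DI: "c {v, w} \<in> D" if "w \<in> verts G" "w \<noteq> v" for w
      using that unfolding D_def by blast
    have leaf: "c {p, q} \<in> D"
      if "p \<in> {x, y, z}" "q \<in> verts G" "q \<notin> {v, x, y, z}" for p q
    proof -
      have "c {p, q} \<in> {c {v, x}, c {v, y}, c {v, z}}"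
        using pendant[of v x y z q] pendant[of v y x z q] pendant[of v z x y q] V d cd that by auto
      then show ?thesis
        using DI V d by auto
    qed
    have outer: "c {p, q} \<in> D"
      if pq: "p \<in> verts G" "q \<in> verts G" "p \<notin> {v, x, y, z}" "q \<notin> {v, x, y, z}" "p \<noteq> q" for p q
    proof -
      \<comment> \<open>The color of \<open>{v, p}\<close> agrees with at most one leg color, so
        \<open>p\<close> can replace a leaf while the star stays rainbow. Then \<open>{p, q}\<close>
        is a pendant edge at the leaf \<open>p\<close>.\<close>
      have "c {p, q} \<in> {c {v, p}, c {v, x}, c {v, y}, c {v, z}}"
      proof -
        consider "distinct [c {v, p}, c {v, x}, c {v, y}]" | "distinct [c {v, p}, c {v, x}, c {v, z}]"
          | "distinct [c {v, p}, c {v, y}, c {v, z}]"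
          using cd by (simp, metis)
        then show ?thesis
        proof cases
          case 1
          then show ?thesis
            using pendant[of v p x y q] V d pq by auto
        next
          case 2
          then show ?thesis
            using pendant[of v p x z q] V d pq by auto
        next
          case 3
          then show ?thesis
            using pendant[of v p y z q] V d pq by auto
        qed
      qed
      then show ?thesis
        using DI[of p] DI[of x] DI[of y] DI[of z] V d pq by auto
    qed
    have "c e \<in> {c {x, y}, c {x, z}, c {y, z}} \<union> D" if e: "e \<in> edges G" for e
    proof -
      obtain p q where pq: "e = {p, q}" "p \<noteq> q" "p \<in> verts G" "q \<in> verts G"
        using simple_graph_edgeE[OF simple e] .
      consider "p = v" | "q = v" | "p \<in> {x, y, z}" "q \<in> {x, y, z}"
        | "p \<in> {x, y, z}" "q \<notin> {v, x, y, z}" | "q \<in> {x, y, z}" "p \<notin> {v, x, y, z}"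
        | "p \<notin> {v, x, y, z}" "q \<notin> {v, x, y, z}"
        by blast
      then show ?thesis
      proof cases
        case 1
        then show ?thesis
          using DI[of q] pq by simp
      next
        case 2
        then show ?thesis
          using DI[of p] pq by (simp add: insert_commute)
      next
        case 3
        then show ?thesis
          using pq(1,2) by (auto simp: insert_commute)
      next
        case 4
        then show ?thesis
          using leaf[of p q] pq by simp
      next
        case 5
        then show ?thesis
          using leaf[of q p] pq by (simp add: insert_commute)
      next
        case 6
        then show ?thesis
          using outer[of p q] pq by simp
      qed
    qed
    \<comment> \<open>Only the three edges among \<open>x\<close>, \<open>y\<close>,
      \<open>z\<close> can carry a color not seen at \<open>v\<close>.\<close>
    then have "c ` edges G \<subseteq> {c {x, y}, c {x, z}, c {y, z}} \<union> D"
      by blast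
    then have "card (c ` edges G) \<le> card ({c {x, y}, c {x, z}, c {y, z}} \<union> D)"
      using fin by (intro card_mono) auto
    also have "\<dots> \<le> card {c {x, y}, c {x, z}, c {y, z}} + card D"
      by (rule card_Un_le)
    also have "card {c {x, y}, c {x, z}, c {y, z}} \<le> 3"
      by (simp add: card_insert_if)
    finally have "5 \<le> card D"
      using card by simp
    moreover have "card D - card {c {v, x}, c {v, y}} \<le> card (D - {c {v, x}, c {v, y}})"
      by (rule diff_card_le_card_Diff) simp
    moreover have "card {c {v, x}, c {v, y}} \<le> 2"
      by (simp add: card_insert_if)
    ultimately have "3 \<le> card (D - {c {v, x}, c {v, y}})"
      by linarith
    then obtain T where T: "T \<subseteq> D - {c {v, x}, c {v, y}}" "card T = 3"
      using obtain_subset_with_card_n by metis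
    obtain i j l where ijl: "T = {i, j, l}" "i \<noteq> j" "i \<noteq> l" "j \<noteq> l"
      using T(2) by (auto simp: card_3_iff)
    have two: "c {x, y} \<in> {m, n}"
      if mn: "m \<in> D - {c {v, x}, c {v, y}}" "n \<in> D - {c {v, x}, c {v, y}}" "m \<noteq> n" for m n
    proof -
      obtain u w where u: "u \<in> verts G" "u \<noteq> v" "m = c {v, u}" and w: "w \<in> verts G" "w \<noteq> v" "n = c {v, w}"
        using mn(1,2) unfolding D_def by blast
      have uw: "u \<noteq> x" "u \<noteq> y" "w \<noteq> x" "w \<noteq> y" "u \<noteq> w"
        using mn u(3) w(3) by auto
      \<comment> \<open>The edge \<open>{x, y}\<close> is read as pendant at \<open>x\<close> for
        the star with leaves \<open>x\<close>, \<open>u\<close>, \<open>w\<close>, and then as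
        pendant at \<open>y\<close> for the star with leaves \<open>y\<close>, \<open>u\<close>,
        \<open>w\<close>. As the legs to \<open>x\<close> and \<open>y\<close> differ in color, only
        \<open>m\<close> and \<open>n\<close> are allowed both times.\<close>
      have "c {x, y} \<in> {c {v, x}, m, n}"
        using pendant[of v x u w y] V d u w uw mn by auto
      moreover have "c {x, y} \<in> {c {v, y}, m, n}"
        using pendant[of v y u w x] V d u w uw mn by (auto simp: insert_commute)
      ultimately show ?thesis
        using cd by auto
    qed
    show False
      using two[of i j] two[of i l] two[of j l] T(1) ijl by auto
  qed
qed

section \<open>The minimum class\<close>

lemma rainbow_le_isomorphic:
  assumes "simple_graph H" "isomorphic H K"
  shows "rainbow_le H L \<longleftrightarrow> rainbow_le K L"
  unfolding rainbow_le_def rainbow_free_isomorphic[OF assms] by (rule refl)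

theorem theorem16:
  "(\<forall>H\<in>conn_graphs. rainbow_le (star_graph 3) H) \<and>
   (\<forall>H\<in>conn_graphs. rainbow_le H (star_graph 3) \<longrightarrow>
      isomorphic H (star_graph 3) \<or> isomorphic H (star_plus_graph 3)) \<and>
   (let M = {H. simple_graph H \<and>
                (isomorphic H (star_graph 3) \<or> isomorphic H (star_plus_graph 3))}
    in M \<in> conn_graphs // rainbow_equiv \<and>
       (\<forall>B\<in>conn_graphs // rainbow_equiv. class_le M B))"
proof -
  define M :: "nat ugraph set" where "M = {H. simple_graph H \<and>
    (isomorphic H (star_graph 3) \<or> isomorphic H (star_plus_graph 3))}"
  have refl: "isomorphic H H" for H :: "nat ugraph"
    unfolding isomorphic_def by (intro exI[of _ id]) simp
  have star: "star_graph 3 \<in> M" "star_graph 3 \<in> conn_graphs"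
    using simple_star_3 refl conn_graphsI_star unfolding M_def by blast+
  have M_le: "rainbow_le H (star_graph 3)" if "H \<in> M" for H
    using that rainbow_le_isomorphic[of H _ "star_graph 3"] rainbow_le_refl star_plus_3_rainbow_le
    unfolding M_def by blast
  have simple: "simple_graph H" if "H \<in> conn_graphs" for H
    using that unfolding conn_graphs_def connected_graph_def by blast
  have conn: "H \<in> conn_graphs" if "H \<in> M" for H
    using that conn_graphsI_star unfolding M_def by blast
  have "H \<in> M" if "H \<in> conn_graphs" "rainbow_le H (star_graph 3)" for H
    using rainbow_le_star_3_cases[OF that(2,1)] simple[OF that(1)] unfolding M_def by blast
  \<comment> \<open>\<open>M\<close> is the full class of the star: the classification of graphs
    below the star gives one inclusion, and \<open>conn\<close>, \<open>M_le\<close> and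
    \<open>star_3_rainbow_le\<close> give the other.\<close>
  then have "M = rainbow_equiv `` {star_graph 3}"
    using conn M_le star(2) star_3_rainbow_le unfolding rainbow_equiv_def by blast
  then have quotient: "M \<in> conn_graphs // rainbow_equiv"
    using star(2) by (simp add: quotientI)
  have "class_le M B" if B: "B \<in> conn_graphs // rainbow_equiv" for B
  proof -
    obtain H where "H \<in> B" "H \<in> conn_graphs"
      using in_quotient_imp_non_empty[OF equiv_rainbow_equiv B]
        in_quotient_imp_subset[OF equiv_rainbow_equiv B] by blast
    then show ?thesis
      using star(1) star_3_rainbow_le unfolding class_le_def by blast
  qed
  then show ?thesis
    using star_3_rainbow_le rainbow_le_star_3_cases quotient unfolding M_def[symmetric] Let_def
    by blast
qed

end
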